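(* Let $q=2^k$ with $k\ge1$, let $b,c\in\mathbb{F}_q$ with $b\neq 0$, and let $d\in\mathbb{F}_{q^2}$. Let $\chi$ be the canonical additive character of $\mathbb{F}_{q^2}$, and let $M$ denote the number of zeros of $f(x)=x^q+bx^2+cx+d\in\mathbb{F}_{q^2}[x]$ in $\mathbb{F}_{q^2}$. Then the following hold. (1) If $c=0$ and $k$ is even, then $M=1+\chi(dx_1)$, where $x_1$ is the unique root of $x^{2q-1}=b$ in $\mathbb{F}_{q^2}$. (2) If $c=0$ and $k$ is odd, then $M=1+\chi(dx_1)+\chi(dx_2)+\chi(dx_3)$, where $x_1,x_2,x_3$ are the three distinct roots of $x^{2q-1}=b$ in $\mathbb{F}_{q^2}$. (3) If $c=1$, then $M=1$. (4) If $c\in\mathbb{F}_q^*\setminus\{1\}$ and $\operatorname{Tr}_{\mathbb{F}_q/\mathbb{F}_2}\left(\frac{1}{(c+1)^4}\right)=0$, then $M=1+\chi\left(\frac{db}{(c+1)^2}\right)$. (5) If $c\in\mathbb{F}_q^*\setminus\{1\}$ and $\operatorname{Tr}_{\mathbb{F}_q/\mathbb{F}_2}\left(\frac{1}{(c+1)^4}\right)=1$, then $$M=1+\chi\left(\frac{db}{(x_1+c)^2}\right)+\chi\left(\frac{db}{(x_2+c)^2}\right)+\chi\left(\frac{db}{(c+1)^2}\right),$$ where $x_1,x_2$ are the two distinct roots of $x^2+(c+1)^2x+1=0$ in $\mu_{q+1}\setminus\{1\}$.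
   Context: $\mathbb{F}_q\subset\mathbb{F}_{q^2}$ are the finite fields with $q$ and $q^2$ elements. $\operatorname{Tr}_{\mathbb{F}_q/\mathbb{F}_2}$ is the absolute trace from $\mathbb{F}_q$ to $\mathbb{F}_2$. The canonical additive character $\psi$ of $\mathbb{F}_q$ is $\psi(x)=(-1)^{\operatorname{Tr}_{\mathbb{F}_q/\mathbb{F}_2}(x)}$, and the canonical additive character of $\mathbb{F}_{q^2}$ is $\chi=\psi\circ\operatorname{Tr}$, where $\operatorname{Tr}:\mathbb{F}_{q^2}\to\mathbb{F}_q$, $\operatorname{Tr}(x)=x^q+x$. $\mu_{q+1}=\{x\in\mathbb{F}_{q^2}^*: x^{q+1}=1\}$. Zeros are counted as distinct elements of $\mathbb{F}_{q^2}$. *)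

theory Defs
  imports Complex_Main "HOL-Computational_Algebra.Polynomial"
begin

definition is_subfield :: "'a::field set \<Rightarrow> bool" where
  "is_subfield K \<longleftrightarrow> 0 \<in> K \<and> 1 \<in> K \<and>
     (\<forall>x\<in>K. \<forall>y\<in>K. x + y \<in> K \<and> x * y \<in> K) \<and>
     (\<forall>x\<in>K. - x \<in> K \<and> inverse x \<in> K)"

(* The absolute trace from the field with 2^k elements to its prime field.
   All fields live inside one type, so the field with two elements is the subset {0, 1}
   of that type.  The value is meaningful only for x in the subfield with 2^k elements. *)
definition abs_trace :: "nat \<Rightarrow> 'a::field \<Rightarrow> 'a" where
  "abs_trace k x = (\<Sum>i<k. x ^ (2 ^ i))"

definition rel_trace :: "nat \<Rightarrow> 'a::field \<Rightarrow> 'a" where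
  "rel_trace q x = x ^ q + x"

(* (-1)^(abs_trace k x): the exponent is an element of the field with two elements,
   so the power is 1 when it is 0 and -1 when it is 1. *)
definition can_char :: "nat \<Rightarrow> 'a::field \<Rightarrow> complex" where
  "can_char k x = (if abs_trace k x = 0 then 1 else - 1)"

definition can_char_ext :: "nat \<Rightarrow> 'a::field \<Rightarrow> complex" where
  "can_char_ext k = can_char k \<circ> rel_trace (2 ^ k)"

definition mu :: "nat \<Rightarrow> 'a::field set" where
  "mu n = {x. x \<noteq> 0 \<and> x ^ n = 1}"

end

theory Submission
  imports Defs "HOL-Library.FuncSet" "HOL-Computational_Algebra.Primes"
begin

text \<open>
  The count reduces to an adjoint equation.  By orthogonality of the additive characters of
  \<open>\<F>\<^sub>Q\<close>, \<open>Q = q\<^sup>2\<close>,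
  \<open>Q \<cdot> M = \<Sum>x. \<Sum>w. \<chi> (w (x\<^sup>q + b x\<^sup>2 + c x + d))\<close>.
  The trace is invariant under Frobenius, so each term of the argument can be brought to a
  multiple of \<open>x\<^sup>2\<close>:
  \<open>\<chi> (w (x\<^sup>q + b x\<^sup>2 + c x)) = \<chi> (x\<^sup>2 (w\<^bsup>2q\<^esup> + c\<^sup>2 w\<^sup>2 + b w))\<close>.
  Summing over \<open>x\<close> first, and using that squaring is a bijection, leaves \<open>M\<close> equal to the sum
  of \<open>\<chi> (d w)\<close> over the solutions \<open>w\<close> of \<open>w\<^bsup>2q\<^esup> + c\<^sup>2 w\<^sup>2 + b w = 0\<close>
  (lemma \<open>card_zeros_eq_sum_char\<close>).  What remains is to solve this equation.

  For \<open>c = 0\<close> the nonzero solutions satisfy \<open>w\<^bsup>2q-1\<^esup> = b\<close>.  As \<open>b\<close> lies in the fixed field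
  of \<open>x \<mapsto> x\<^sup>q\<close>, it is itself a solution, and the others are its multiples by the roots of
  \<open>u\<^bsup>2q-1\<^esup> = 1\<close>.  Since \<open>(2q-1)(2q+1) = 4(q\<^sup>2-1) + 3\<close>, those are cube roots of unity; all
  three occur when \<open>3\<close> divides \<open>2q-1\<close>, that is for odd \<open>k\<close>, and only \<open>1\<close> otherwise.

  For \<open>c = 1\<close> the equation reads \<open>t\<^sup>2 = b w\<close> with \<open>t = w\<^sup>q + w\<close> in the fixed field, whence \<open>w\<close>
  is in the fixed field too, so \<open>t = 0\<close> and \<open>w = 0\<close>.

  For the other \<open>c\<close>, a nonzero solution is recovered from the norm-one element
  \<open>u = w\<^bsup>q-1\<^esup>\<close> as \<open>w = b / (u + c)\<^sup>2\<close>, and applying Frobenius to \<open>w (u + c)\<^sup>2 = b\<close> shows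
  that \<open>u\<close> satisfies \<open>(u + 1)(u\<^sup>2 + (c+1)\<^sup>2 u + 1) = 0\<close>; conversely every such \<open>u\<close> of norm one
  gives a solution (lemma \<open>adjoint_zeros_generic\<close>).  With \<open>a = (c+1)\<^sup>2\<close> and \<open>u = a v\<close> the
  quadratic factor becomes the Artin-Schreier equation \<open>v\<^sup>2 + v = 1/a\<^sup>2\<close>.  It is solvable in
  \<open>\<F>\<^sub>Q\<close> because the absolute trace of an element of the fixed field vanishes there, and its
  solutions satisfy \<open>v\<^sup>q + v = Tr (1/a\<^sup>2)\<close>.  If this trace is \<open>1\<close>, both roots have norm one; if
  it is \<open>0\<close>, they lie in the fixed field, whose only element of norm one is \<open>1\<close>, not a root as
  \<open>a \<noteq> 0\<close>.
\<close>

section \<open>Finite fields of characteristic two\<close>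

text \<open>Multiplication by \<open>x\<close> permutes the nonzero elements of a subfield, so their product is
  invariant under multiplication by \<open>x\<^bsup>q-1\<^esup>\<close>.\<close>

lemma subfield_power_card:
  fixes K :: "'a::{field,finite} set"
  assumes K: "is_subfield K" and x: "x \<in> K"
  shows "x ^ card K = x"
proof (cases "x = 0")
  case True
  have "card K > 0"
    using x by (auto simp: card_gt_0_iff)
  then show ?thesis using True by simp
next
  case False
  define S where "S = K - {0}"
  have card_S: "card K = Suc (card S)"
    unfolding S_def using K by (intro card.remove) (auto simp: is_subfield_def)
  have "bij_betw (\<lambda>y. x * y) S S"
  proof (rule bij_betwI[where g = "\<lambda>y. inverse x * y"])
    show "(\<lambda>y. x * y) \<in> S \<rightarrow> S" "(\<lambda>y. inverse x * y) \<in> S \<rightarrow> S"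
      using K x False by (auto simp: S_def is_subfield_def)
  qed (use False in auto)
  then have "(\<Prod>y\<in>S. x * y) = (\<Prod>y\<in>S. y)"
    by (rule prod.reindex_bij_betw)
  then have "x ^ card S * (\<Prod>y\<in>S. y) = (\<Prod>y\<in>S. y)"
    by (simp add: prod.distrib)
  moreover have "(\<Prod>y\<in>S. y) \<noteq> 0"
    by (simp add: S_def)
  ultimately have "x ^ card S = 1"
    by simp
  then show ?thesis by (simp add: card_S)
qed

text \<open>The parameter \<open>ty\<close> carries no information beyond its type; it names the field, so that
  an interpretation can choose it.\<close>

locale binary_field =
  fixes n :: nat and ty :: "'a::{field,finite} itself"
  assumes card_UNIV: "card (UNIV :: 'a set) = 2 ^ n"
    and n_pos: "n > 0"
begin

lemma power_card_eq_self: "x ^ (2 ^ n) = (x::'a)"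
  using subfield_power_card[of UNIV x] by (simp add: is_subfield_def card_UNIV)

text \<open>The translation \<open>x \<mapsto> x + 1\<close> permutes the field, so comparing the sums of all elements
  shows that the cardinality, a power of two, is zero in the field.\<close>

lemma two_eq_zero: "(2::'a) = 0"
proof -
  have "bij_betw (\<lambda>x. x + 1) (UNIV :: 'a set) UNIV"
    by (rule bij_betwI[where g = "\<lambda>x. x - 1"]) auto
  then have "(\<Sum>x\<in>(UNIV :: 'a set). x + 1) = (\<Sum>x\<in>UNIV. x)"
    by (rule sum.reindex_bij_betw)
  then have "of_nat (card (UNIV :: 'a set)) = (0::'a)"
    by (simp add: sum.distrib)
  then have "(2::'a) ^ n = 0"
    by (simp add: card_UNIV)
  then show ?thesis by simp
qed

lemma add_self: "x + x = (0::'a)"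
  by (metis two_eq_zero mult_2 mult_zero_left)

lemma uminus_eq_self: "- x = (x::'a)"
  by (metis add_self add_eq_0_iff)

lemma add_eq_0_iff_eq: "x + y = 0 \<longleftrightarrow> x = (y::'a)"
  by (metis add_eq_0_iff uminus_eq_self)

lemma CHAR_eq_two: "CHAR('a) = 2"
proof -
  have "CHAR('a) dvd 2"
    using two_eq_zero of_nat_eq_0_iff_char_dvd[where 'a = 'a, of 2] by simp
  moreover have "CHAR('a) \<noteq> 1"
    by simp
  ultimately show ?thesis
    using prime_nat_iff two_is_prime_nat by blast
qed

lemma frobenius_add: "(x + y :: 'a) ^ (2 ^ i) = x ^ (2 ^ i) + y ^ (2 ^ i)"
  by (rule freshmans_dream') (simp_all add: CHAR_eq_two)

lemma square_add: "(x + y :: 'a)\<^sup>2 = x\<^sup>2 + y\<^sup>2"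
  using frobenius_add[of x y 1] by simp

lemma power2_eq_iff_eq: "x\<^sup>2 = y\<^sup>2 \<longleftrightarrow> x = (y::'a)"
  by (metis add_eq_0_iff_eq square_add zero_eq_power2)

lemma bij_square: "bij (\<lambda>x::'a. x\<^sup>2)"
  using finite_UNIV_inj_surj[of "\<lambda>x::'a. x\<^sup>2"]
  by (auto simp: bij_def inj_def power2_eq_iff_eq)

lemma abs_trace_add: "abs_trace m (x + y :: 'a) = abs_trace m x + abs_trace m y"
  by (simp add: abs_trace_def frobenius_add sum.distrib)

text \<open>The sum telescopes because equal terms cancel in characteristic two.\<close>

lemma abs_trace_artin_schreier: "abs_trace m (v\<^sup>2 + v :: 'a) = v ^ (2 ^ m) + v"
proof (induction m)
  case 0
  show ?case by (simp add: abs_trace_def add_self)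
next
  case (Suc m)
  have "abs_trace (Suc m) (v\<^sup>2 + v) = abs_trace m (v\<^sup>2 + v) + (v\<^sup>2 + v) ^ (2 ^ m)"
    by (simp add: abs_trace_def)
  also have "\<dots> = v ^ (2 ^ Suc m) + v + (v ^ (2 ^ m) + v ^ (2 ^ m))"
    by (simp only: Suc frobenius_add flip: power_mult) (simp add: ac_simps)
  finally show ?case by (simp add: add_self)
qed

text \<open>As a polynomial of degree \<open>2\<^bsup>m-1\<^esup>\<close>, the trace cannot vanish more often than that.\<close>

lemma card_abs_trace_eq_0_le:
  assumes "m > 0"
  shows "card {x::'a. abs_trace m x = 0} \<le> 2 ^ (m - 1)"
proof -
  define p :: "'a poly" where "p = (\<Sum>i<m. monom 1 (2 ^ i))"
  have "coeff p 1 = (\<Sum>i<m. if i = 0 then 1 else 0)"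
    unfolding p_def coeff_sum by (rule sum.cong) auto
  also have "\<dots> = 1"
    using assms by simp
  finally have "p \<noteq> 0" by auto
  then have "card {x. poly p x = 0} \<le> degree p"
    by (rule card_poly_roots_bound)
  also have "degree p \<le> 2 ^ (m - 1)"
    unfolding p_def
  proof (rule degree_sum_le)
    fix i assume "i \<in> {..<m}"
    then have "(2::nat) ^ i \<le> 2 ^ (m - 1)"
      by (intro power_increasing) auto
    then show "degree (monom (1::'a) (2 ^ i)) \<le> 2 ^ (m - 1)"
      by (rule order_trans[OF degree_monom_le])
  qed auto
  finally show ?thesis
    by (simp add: p_def poly_sum poly_monom abs_trace_def)
qed

text \<open>The additive form of Hilbert's Theorem 90, by counting: the map \<open>v \<mapsto> v\<^sup>2 + v\<close> is two-to-one,
  so its image fills the kernel of the trace, which contains it.\<close>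

lemma artin_schreier_solvable:
  assumes "abs_trace n (e::'a) = 0"
  obtains v where "v\<^sup>2 + v = e"
proof -
  define g where "g = (\<lambda>v::'a. v\<^sup>2 + v)"
  have fiber: "{w. g w = g v} = {v, v + 1}" for v
  proof -
    have "g w = g v \<longleftrightarrow> w = v \<or> w = v + 1" for w
    proof -
      have "g w + g v = (w + v) * (w + (v + 1)) - 2 * (w * v)"
        unfolding g_def by (simp add: algebra_simps power2_eq_square)
      then show ?thesis
        by (metis add_eq_0_iff_eq diff_zero mult_eq_0_iff two_eq_zero)
    qed
    then show ?thesis by auto
  qed
  have "card (UNIV :: 'a set) = (\<Sum>y\<in>range g. card {v. g v = y})"
    using sum.image_gen[of UNIV "\<lambda>_. 1::nat" g] by simp
  also have "\<dots> = (\<Sum>y\<in>range g. 2)"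
    by (rule sum.cong) (auto simp: fiber)
  finally have "2 * card (range g) = 2 ^ n"
    by (simp add: card_UNIV)
  then have card_range: "card (range g) = 2 ^ (n - 1)"
    using n_pos by (cases n) auto
  have "range g \<subseteq> {x. abs_trace n x = 0}"
    by (auto simp: g_def abs_trace_artin_schreier power_card_eq_self add_self)
  then have "range g = {x. abs_trace n x = 0}"
    using card_abs_trace_eq_0_le[OF n_pos] card_range by (intro card_seteq) auto
  then have "e \<in> range g"
    using assms by simp
  then show thesis
    using that by (auto simp: g_def)
qed

section \<open>Orthogonality of the canonical characters\<close>

lemma abs_trace_square: "abs_trace n (x\<^sup>2) = abs_trace n (x::'a)"
proof -
  have "abs_trace n (x\<^sup>2) + abs_trace n x = 0"
    using abs_trace_artin_schreier[of n x]
    by (simp add: abs_trace_add power_card_eq_self add_self)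
  then show ?thesis by (simp add: add_eq_0_iff_eq)
qed

lemma abs_trace_eq_0_or_1: "abs_trace n (x::'a) = 0 \<or> abs_trace n x = 1"
proof -
  have "(abs_trace n x)\<^sup>2 = (\<Sum>i<n. (x ^ 2 ^ i)\<^sup>2)"
    unfolding abs_trace_def by (rule freshmans_dream_sum) (simp_all add: CHAR_eq_two)
  also have "\<dots> = abs_trace n (x\<^sup>2)"
    unfolding abs_trace_def by (intro sum.cong refl) (metis mult.commute power_mult)
  finally have "(abs_trace n x)\<^sup>2 = abs_trace n x"
    by (simp only: abs_trace_square)
  then have "abs_trace n x * (abs_trace n x - 1) = 0"
    unfolding right_diff_distrib power2_eq_square by simp
  then show ?thesis by simp
qed

lemma can_char_add: "can_char n (x + y :: 'a) = can_char n x * can_char n y"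
  using abs_trace_eq_0_or_1[of x] abs_trace_eq_0_or_1[of y]
  by (auto simp: can_char_def abs_trace_add add_self)

lemma can_char_0: "can_char n (0::'a) = 1"
  by (simp add: can_char_def abs_trace_def power_0_left)

lemma can_char_frobenius: "can_char n (x ^ (2 ^ i)) = can_char n (x::'a)"
proof (induction i)
  case (Suc i)
  have "can_char n (x ^ (2 ^ Suc i)) = can_char n ((x ^ (2 ^ i))\<^sup>2)"
    by (simp add: mult.commute flip: power_mult)
  also have "\<dots> = can_char n (x ^ (2 ^ i))"
    by (simp add: can_char_def abs_trace_square)
  finally show ?case using Suc by simp
qed simp

lemma can_char_nontrivial: obtains y :: 'a where "can_char n y = - 1"
proof -
  have "{x::'a. abs_trace n x = 0} \<noteq> UNIV"
  proof
    assume all: "{x::'a. abs_trace n x = 0} = UNIV"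
    have "(2::nat) ^ n \<le> 2 ^ (n - 1)"
      using card_abs_trace_eq_0_le[OF n_pos] unfolding all card_UNIV .
    then show False
      using n_pos by (cases n) auto
  qed
  then obtain y :: 'a where "abs_trace n y \<noteq> 0"
    by auto
  then show thesis
    by (intro that[of y]) (simp add: can_char_def)
qed

lemma sum_can_char_mult:
  fixes z :: 'a
  shows "(\<Sum>x\<in>UNIV. can_char n (x * z)) = (if z = 0 then 2 ^ n else (0::complex))"
proof (cases "z = 0")
  case True
  then show ?thesis by (simp add: can_char_0 card_UNIV)
next
  case False
  define S where "S = (\<Sum>x\<in>UNIV. can_char n (x * z))"
  obtain y :: 'a where y: "can_char n y = - 1"
    by (rule can_char_nontrivial)
  have "bij_betw (\<lambda>x. x + y / z) (UNIV :: 'a set) UNIV"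
    by (rule bij_betwI[where g = "\<lambda>x. x - y / z"]) auto
  then have "S = (\<Sum>x\<in>UNIV. can_char n ((x + y / z) * z))"
    unfolding S_def by (rule sum.reindex_bij_betw[symmetric])
  also have "\<dots> = (\<Sum>x\<in>UNIV. - can_char n (x * z))"
    using False by (intro sum.cong) (simp_all add: distrib_right can_char_add y)
  also have "\<dots> = - S"
    by (simp add: S_def sum_negf)
  finally have "S = 0"
    by simp
  then show ?thesis
    using False by (simp add: S_def)
qed

text \<open>Counting zeros by characters.  The map \<open>A\<close> plays the role of the adjoint of \<open>L\<close>, twisted by
  a square so that no square roots of coefficients are needed.\<close>

lemma card_zeros_eq_sum_char:
  fixes L A :: "'a \<Rightarrow> 'a"
  assumes adj: "\<And>w x. can_char n (w * L x) = can_char n (x\<^sup>2 * A w)"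
  shows "of_nat (card {x. L x + d = 0}) = (\<Sum>w\<in>{w. A w = 0}. can_char n (d * w))"
proof -
  have "2 ^ n * of_nat (card {x. L x + d = 0})
      = (\<Sum>x\<in>UNIV. if L x + d = 0 then 2 ^ n else (0::complex))"
    by (simp add: sum.If_cases)
  also have "\<dots> = (\<Sum>x\<in>UNIV. \<Sum>w\<in>UNIV. can_char n (w * (L x + d)))"
    by (simp add: sum_can_char_mult)
  also have "\<dots> = (\<Sum>w\<in>UNIV. \<Sum>x\<in>UNIV. can_char n (w * (L x + d)))"
    by (rule sum.swap)
  also have "\<dots> = (\<Sum>w\<in>UNIV. can_char n (d * w) * (\<Sum>x\<in>UNIV. can_char n (x\<^sup>2 * A w)))"
    by (simp add: distrib_left can_char_add adj sum_distrib_left mult.commute)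
  also have "\<dots> = (\<Sum>w\<in>UNIV. can_char n (d * w) * (\<Sum>x\<in>UNIV. can_char n (x * A w)))"
    by (simp add: sum.reindex_bij_betw[OF bij_square, of "\<lambda>x. can_char n (x * _)"])
  also have "\<dots> = (\<Sum>w\<in>UNIV. if A w = 0 then 2 ^ n * can_char n (d * w) else 0)"
    by (intro sum.cong) (simp_all add: sum_can_char_mult)
  also have "\<dots> = 2 ^ n * (\<Sum>w\<in>{w. A w = 0}. can_char n (d * w))"
    by (simp add: sum.If_cases sum_distrib_left)
  finally show ?thesis by simp
qed

end

section \<open>The quadratic extension and the adjoint equation\<close>

locale binary_quadratic_extension =
  fixes k q :: nat and ty :: "'a::{field,finite} itself"
  assumes k_pos: "k > 0" and q_def: "q = 2 ^ k"
    and card_ext: "card (UNIV :: 'a set) = q\<^sup>2"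

sublocale binary_quadratic_extension \<subseteq> binary_field "2 * k" ty
  by unfold_locales (simp_all add: k_pos card_ext q_def mult.commute flip: power_mult)

context binary_quadratic_extension
begin

lemma q_pos: "q > 0"
  by (simp add: q_def)

lemma power_q_add: "(x + y :: 'a) ^ q = x ^ q + y ^ q"
  by (simp add: q_def frobenius_add)

lemma power_q_power_q: "(x ^ q) ^ q = (x::'a)"
  using power_card_eq_self[of x]
  by (simp add: q_def mult_2 power_add flip: power_mult)

text \<open>Transitivity of the trace: the summands of the absolute trace of the large field with
  exponents \<open>2\<^bsup>k+i\<^esup>\<close> are those of the small one, taken at \<open>x\<^sup>q\<close>.\<close>

lemma abs_trace_rel_trace: "abs_trace k (x ^ q + x) = abs_trace (2 * k) (x::'a)"
proof -
  have "abs_trace (k + m) x = abs_trace k x + abs_trace m (x ^ q)" for m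
    by (induction m) (simp_all add: abs_trace_def q_def power_add power_mult add.assoc)
  from this[of k] show ?thesis
    by (simp add: abs_trace_add add.commute mult_2)
qed

lemma can_char_ext_eq: "can_char_ext k = (can_char (2 * k) :: 'a \<Rightarrow> complex)"
  by (rule ext) (simp add: can_char_ext_def can_char_def rel_trace_def abs_trace_rel_trace flip: q_def)

text \<open>To bring each term of \<open>w (x\<^sup>q + b x\<^sup>2 + c x)\<close> to a multiple of \<open>x\<^sup>2\<close> without changing
  its character, raise the first to the power \<open>2q\<close> (where \<open>(x\<^sup>q)\<^sup>q = x\<close>) and square the last.\<close>

lemma card_zeros_eq_sum_adjoint:
  fixes b c d :: 'a
  shows "of_nat (card {x. x ^ q + b * x\<^sup>2 + c * x + d = 0})
       = (\<Sum>w\<in>{w. w ^ (2 * q) + c\<^sup>2 * w\<^sup>2 + b * w = 0}. can_char_ext k (d * w))"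
  unfolding can_char_ext_eq
proof (rule card_zeros_eq_sum_char)
  fix w x :: 'a
  have "(w * x ^ q) ^ (2 ^ Suc k) = (w * x ^ q) ^ (q * 2)"
    by (simp add: q_def mult.commute)
  also have "\<dots> = x\<^sup>2 * w ^ (2 * q)"
    by (simp add: power_mult power_mult_distrib power_q_power_q mult.commute flip: power_mult)
       (simp add: power_mult power_q_power_q mult.commute)
  finally have frob: "can_char (2 * k) (w * x ^ q) = can_char (2 * k) (x\<^sup>2 * w ^ (2 * q))"
    using can_char_frobenius[of "w * x ^ q" "Suc k"] by simp
  have square: "can_char (2 * k) (w * (c * x)) = can_char (2 * k) (x\<^sup>2 * (c\<^sup>2 * w\<^sup>2))"
    using can_char_frobenius[of "w * (c * x)" 1] by (simp add: power_mult_distrib mult_ac)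
  show "can_char (2 * k) (w * (x ^ q + b * x\<^sup>2 + c * x))
      = can_char (2 * k) (x\<^sup>2 * (w ^ (2 * q) + c\<^sup>2 * w\<^sup>2 + b * w))"
    by (simp add: distrib_left can_char_add frob square) (simp add: mult_ac)
qed

section \<open>The case \<open>c = 0\<close>: cube roots of unity\<close>

lemma power_eq_one_imp_cube:
  assumes "(u::'a) ^ (2 * q - 1) = 1"
  shows "u ^ 3 = 1"
proof -
  have "u \<noteq> 0"
    using assms q_pos by (auto simp: power_0_left split: if_splits)
  have "u ^ (q * q) = u"
    by (simp add: power_mult power_q_power_q)
  \<comment> \<open>\<open>4 q\<^sup>2 - 1 = (2q - 1)(2q + 1)\<close>, and \<open>u\<close> raised to the power \<open>4 q\<^sup>2\<close> is \<open>u\<^sup>4\<close>.\<close>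
  then have "u ^ 4 = u ^ (4 * (q * q))"
    by (metis mult.commute power_mult)
  also have "4 * (q * q) = (2 * q - 1) * (2 * q + 1) + 1"
    using q_pos by (cases q) (simp_all add: algebra_simps)
  also have "u ^ \<dots> = u"
    by (simp only: power_add power_mult assms) simp
  finally show ?thesis
    using \<open>u \<noteq> 0\<close> by (simp add: eval_nat_numeral)
qed

text \<open>Since \<open>b\<^sup>q = b\<close>, also \<open>b\<^bsup>2q-1\<^esup> = b\<close>, so that dividing by \<open>b\<close> makes the equation
  homogeneous.\<close>

lemma roots_eq_image_roots_of_unity:
  assumes "b ^ q = b" and "(b::'a) \<noteq> 0"
  shows "{x. x ^ (2 * q - 1) = b} = (\<lambda>u. b * u) ` {u. u ^ (2 * q - 1) = 1}"
proof -
  have "b * b ^ (2 * q - 1) = (b ^ q) * (b ^ q)"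
    using q_pos by (simp flip: power_Suc power_add) (simp add: mult_2)
  then have "b ^ (2 * q - 1) = b"
    using assms by simp
  then show ?thesis
    using assms(2)
    by (auto simp: power_mult_distrib power_divide image_iff intro!: exI[of _ "_ / b"])
qed

lemma roots_of_unity_even:
  assumes "even k"
  shows "{u::'a. u ^ (2 * q - 1) = 1} = {1}"
proof -
  obtain j where j: "k = 2 * j"
    using assms by (elim evenE)
  have "q mod 3 = 1"
    unfolding q_def j power_mult by (simp flip: power_mod)
  then obtain m where m: "q = 3 * m + 1"
    by (metis mult_div_mod_eq)
  have "u = 1" if u: "u ^ (2 * q - 1) = 1" for u :: 'a
  proof -
    have "2 * q - 1 = 3 * (2 * m) + 1"
      using m by simp
    then have "u ^ (2 * q - 1) = (u ^ 3) ^ (2 * m) * u"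
      by (simp only: power_add power_mult power_one_right)
    then show ?thesis
      using u power_eq_one_imp_cube[OF u] by simp
  qed
  then show ?thesis by auto
qed

lemma roots_of_unity_odd:
  assumes "odd k"
  obtains v :: 'a where "{u. u ^ (2 * q - 1) = 1} = {1, v, v + 1}" "distinct [1, v, v + 1]"
proof -
  have "abs_trace (2 * k) (1::'a) = 0"
    by (simp add: abs_trace_def two_eq_zero)
  \<comment> \<open>A primitive cube root of unity is a root of \<open>v\<^sup>2 + v = 1\<close>.\<close>
  then obtain v :: 'a where v: "v\<^sup>2 + v = 1"
    by (rule artin_schreier_solvable)
  obtain j where j: "k = 2 * j + 1"
    using assms by (elim oddE)
  have "q mod 3 = 2"
    unfolding q_def j power_add power_mult by (simp add: mod_mult_left_eq[symmetric] flip: power_mod)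
  then obtain m where m: "q = 3 * m + 2"
    by (metis mult_div_mod_eq)
  have exponent: "2 * q - 1 = 3 * (2 * m + 1)"
    using m by simp
  have cube: "u ^ (2 * q - 1) = 1 \<longleftrightarrow> u ^ 3 = 1" for u :: 'a
  proof
    assume "u ^ 3 = 1"
    then show "u ^ (2 * q - 1) = 1"
      by (simp only: exponent power_mult power_one)
  qed (rule power_eq_one_imp_cube)
  have factor: "u ^ 3 = 1 \<longleftrightarrow> u = 1 \<or> u = v \<or> u = v + 1" for u
  proof -
    have "u ^ 3 + 1 = (u + 1) * ((u + v) * (u + (v + 1))) + (u + 1) * (1 - (v\<^sup>2 + v)) - 2 * ((u + 1) * (u * v + u))"
      by (simp add: algebra_simps power2_eq_square power3_eq_cube)
    then have "u ^ 3 + 1 = (u + 1) * ((u + v) * (u + (v + 1)))"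
      by (simp add: v two_eq_zero)
    then show ?thesis
      by (metis add_eq_0_iff_eq mult_eq_0_iff)
  qed
  show thesis
  proof (rule that)
    show "{u. u ^ (2 * q - 1) = 1} = {1, v, v + 1}"
      by (simp only: cube factor) auto
    show "distinct [1, v, v + 1]"
      using v by (auto simp: add_self)
  qed
qed

lemma adjoint_zeros_c_0:
  fixes b :: 'a
  shows "{w. w ^ (2 * q) + 0\<^sup>2 * w\<^sup>2 + b * w = 0} = insert 0 {x. x ^ (2 * q - 1) = b}"
proof -
  have "w ^ (2 * q) = w ^ (2 * q - 1) * w" for w :: 'a
    using q_pos by (simp flip: power_Suc2)
  then have "w ^ (2 * q) + 0\<^sup>2 * w\<^sup>2 + b * w = (w ^ (2 * q - 1) + b) * w" for w
    by (simp add: algebra_simps)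
  then show ?thesis
    by (auto simp: add_eq_0_iff_eq)
qed

section \<open>The cases \<open>c \<noteq> 0\<close>\<close>

lemma adjoint_zeros_c_1:
  fixes b :: 'a
  assumes b: "b ^ q = b" "b \<noteq> 0"
  shows "{w. w ^ (2 * q) + 1\<^sup>2 * w\<^sup>2 + b * w = 0} = {0}"
proof -
  have "w = 0" if w: "w ^ (2 * q) + 1\<^sup>2 * w\<^sup>2 + b * w = 0" for w
  proof -
    define t where "t = w ^ q + w"
    have "t\<^sup>2 = w ^ (2 * q) + w\<^sup>2"
      unfolding t_def square_add by (simp add: mult.commute flip: power_mult)
    then have t_sq: "t\<^sup>2 = b * w"
      using w by (simp add: add_eq_0_iff_eq)
    have "t ^ q = t"
      by (simp add: t_def power_q_add power_q_power_q add.commute)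
    then have "(t\<^sup>2) ^ q = t\<^sup>2"
      by (metis mult.commute power_mult)
    then have "w ^ q = w"
      unfolding t_sq power_mult_distrib b(1) using b(2) by simp
    then have "t = 0"
      by (simp add: t_def add_self)
    then show ?thesis
      using t_sq b(2) by simp
  qed
  moreover have "0 ^ (2 * q) + 1\<^sup>2 * 0\<^sup>2 + b * 0 = 0"
    using q_pos by simp
  ultimately show ?thesis by blast
qed

text \<open>An element of norm one in the fixed field squares to \<open>1\<close>, hence equals \<open>1\<close>.\<close>

lemma norm_one_fixed:
  assumes "(u::'a) ^ (q + 1) = 1" "u ^ q = u"
  shows "u = 1"
  using assms power2_eq_iff_eq[of u 1] by (simp add: power2_eq_square)

text \<open>The cubic \<open>(u + 1)(u\<^sup>2 + (c+1)\<^sup>2 u + 1)\<close> is, in characteristic two, the sum of the two sides of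
  the relation below, which is \<open>w (u + c)\<^sup>2 = b\<close> compared with its Frobenius image.\<close>

lemma cubic_iff:
  fixes u c :: 'a
  shows "u * (u + c)\<^sup>2 = (1 + c * u)\<^sup>2 \<longleftrightarrow> u = 1 \<or> u\<^sup>2 + (c + 1)\<^sup>2 * u + 1 = 0"
proof -
  have "(u + 1) * (u\<^sup>2 + (c + 1)\<^sup>2 * u + 1) = u * (u + c)\<^sup>2 + (1 + c * u)\<^sup>2 + 2 * (u\<^sup>2 + u)"
    by (simp add: algebra_simps power2_eq_square)
  then show ?thesis
    by (metis add_eq_0_iff_eq add.right_neutral mult_eq_0_iff mult_zero_left two_eq_zero)
qed

text \<open>The parameter of a nonzero solution \<open>w\<close> is \<open>u = w\<^bsup>q-1\<^esup>\<close>.  The root \<open>u = 1\<close> of the cubic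
  gives the solution \<open>b / (c + 1)\<^sup>2\<close>, the only nonzero one in the fixed field.  The denominators
  do not vanish, because \<open>u = c\<close> would be in the fixed field and of norm one, hence \<open>1\<close>.\<close>

lemma adjoint_zeros_generic:
  fixes b c :: 'a
  assumes b: "b ^ q = b" "b \<noteq> 0" and c: "c ^ q = c" "c \<noteq> 1"
  defines "R \<equiv> {u. u ^ (q + 1) = 1 \<and> (u = 1 \<or> u\<^sup>2 + (c + 1)\<^sup>2 * u + 1 = 0)}"
  shows "{w. w ^ (2 * q) + c\<^sup>2 * w\<^sup>2 + b * w = 0} = insert 0 ((\<lambda>u. b / (u + c)\<^sup>2) ` R)"
    and "inj_on (\<lambda>u. b / (u + c)\<^sup>2) R"
    and "\<And>u. u \<in> R \<Longrightarrow> b / (u + c)\<^sup>2 \<noteq> 0"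
proof -
  have nz: "u + c \<noteq> 0" if "u ^ (q + 1) = 1" for u
    using norm_one_fixed[OF that] c by (auto simp: add_eq_0_iff_eq)
  then show "b / (u + c)\<^sup>2 \<noteq> 0" if "u \<in> R" for u
    using that b by (simp add: R_def)
  show "inj_on (\<lambda>u. b / (u + c)\<^sup>2) R"
    using nz b by (auto simp: inj_on_def R_def frac_eq_eq power2_eq_iff_eq)
  have "w \<in> (\<lambda>u. b / (u + c)\<^sup>2) ` R"
    if w: "w ^ (2 * q) + c\<^sup>2 * w\<^sup>2 + b * w = 0" and "w \<noteq> 0" for w
  proof -
    define u where "u = w ^ q / w"
    have wq: "w ^ q = u * w"
      using \<open>w \<noteq> 0\<close> by (simp add: u_def)
    have uq: "u * u ^ q = 1"
      using \<open>w \<noteq> 0\<close> by (simp add: u_def power_divide power_q_power_q)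
    have "w ^ (2 * q) = (u * w)\<^sup>2"
      by (metis wq mult.commute power_mult)
    then have "w * ((u + c)\<^sup>2 * w + b) = 0"
      using w unfolding square_add by (simp add: algebra_simps power2_eq_square)
    then have eq: "(u + c)\<^sup>2 * w = b"
      using \<open>w \<noteq> 0\<close> by (simp add: add_eq_0_iff_eq)
    have "((u + c)\<^sup>2 * w) ^ q = (u ^ q + c)\<^sup>2 * (u * w)"
      by (simp add: power_mult_distrib wq power_q_add c flip: power_mult)
         (simp add: mult.commute power_mult power_q_add c)
    then have "b = (u ^ q + c)\<^sup>2 * (u * w)"
      unfolding eq b(1) .
    then have "u * b = u * ((u ^ q + c)\<^sup>2 * (u * w))"
      by (rule arg_cong)
    also have "\<dots> = (u * (u ^ q + c))\<^sup>2 * w"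
      by (simp add: power_mult_distrib power2_eq_square mult_ac)
    also have "u * (u ^ q + c) = 1 + c * u"
      by (simp add: distrib_left uq mult.commute)
    finally have "u * (u + c)\<^sup>2 = (1 + c * u)\<^sup>2"
      using eq \<open>w \<noteq> 0\<close> by (metis mult.assoc mult_right_cancel)
    then have "u \<in> R"
      using uq by (simp add: R_def cubic_iff)
    moreover have "w = b / (u + c)\<^sup>2"
      using eq b by (auto simp: field_simps)
    ultimately show ?thesis by blast
  qed
  moreover have "w ^ (2 * q) + c\<^sup>2 * w\<^sup>2 + b * w = 0"
    if u: "u \<in> R" and w: "w = b / (u + c)\<^sup>2" for u w
  proof -
    have uq: "u * u ^ q = 1" and cubic: "u * (u + c)\<^sup>2 = (1 + c * u)\<^sup>2"
      using u by (auto simp: R_def cubic_iff)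
    have "u \<noteq> 0" "u + c \<noteq> 0"
      using uq nz[of u] by auto
    have "w ^ q = b / (u ^ q + c)\<^sup>2"
      by (simp add: w power_divide b flip: power_mult)
         (simp add: mult.commute power_mult power_q_add c)
    also have "\<dots> = u\<^sup>2 * b / (u * (u ^ q + c))\<^sup>2"
      using \<open>u \<noteq> 0\<close> by (simp add: power_mult_distrib)
    also have "u * (u ^ q + c) = 1 + c * u"
      by (simp add: distrib_left uq mult.commute)
    also have "u\<^sup>2 * b / (1 + c * u)\<^sup>2 = u\<^sup>2 * b / (u * (u + c)\<^sup>2)"
      by (simp only: cubic)
    also have "\<dots> = u * w"
      using \<open>u \<noteq> 0\<close> by (simp add: w power2_eq_square)
    finally have wq: "w ^ q = u * w" .
    have "(u + c)\<^sup>2 * w = b"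
      using \<open>u + c \<noteq> 0\<close> by (simp add: w)
    then have "b * w = (u\<^sup>2 + c\<^sup>2) * w * w"
      by (simp only: square_add)
    also have "\<dots> = u\<^sup>2 * w\<^sup>2 + c\<^sup>2 * w\<^sup>2"
      by (simp add: algebra_simps power2_eq_square)
    finally have "b * w = u\<^sup>2 * w\<^sup>2 + c\<^sup>2 * w\<^sup>2" .
    moreover have "w ^ (2 * q) = u\<^sup>2 * w\<^sup>2"
      by (metis wq mult.commute power_mult power_mult_distrib)
    ultimately show ?thesis
      by (simp add: add_eq_0_iff_eq two_eq_zero)
  qed
  moreover have "0 ^ (2 * q) + c\<^sup>2 * 0\<^sup>2 + b * 0 = 0"
    using q_pos by simp
  ultimately show "{w. w ^ (2 * q) + c\<^sup>2 * w\<^sup>2 + b * w = 0}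
      = insert 0 ((\<lambda>u. b / (u + c)\<^sup>2) ` R)"
    by blast
qed

text \<open>Substituting \<open>u = a v\<close> turns \<open>u\<^sup>2 + a u + 1 = 0\<close> into \<open>v\<^sup>2 + v = 1 / a\<^sup>2\<close>, and the
  \<open>q\<close>-Frobenius acts on its solutions by adding the trace of the right-hand side.\<close>

lemma quadratic_roots:
  fixes a :: 'a
  assumes a: "a ^ q = a" "a \<noteq> 0"
  obtains v where "\<forall>u. u\<^sup>2 + a * u + 1 = 0 \<longleftrightarrow> u = a * v \<or> u = a * v + a"
    and "v ^ q + v = abs_trace k (1 / a\<^sup>2)" and "a * v * (a * v + a) = 1"
proof -
  define e where "e = 1 / a\<^sup>2"
  have "e ^ q = e"
    by (simp add: e_def power_divide flip: power_mult) (simp add: mult.commute power_mult a)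
  then have "abs_trace (2 * k) e = abs_trace k (0::'a)"
    by (metis abs_trace_rel_trace add_self)
  then have "abs_trace (2 * k) e = 0"
    by (simp add: abs_trace_def power_0_left)
  then obtain v where v: "v\<^sup>2 + v = e"
    by (rule artin_schreier_solvable)
  have "a * v * (a * v + a) = a\<^sup>2 * (v\<^sup>2 + v)"
    by (simp add: algebra_simps power2_eq_square)
  then have prod: "a * v * (a * v + a) = 1"
    using a by (simp add: v e_def)
  have roots: "u\<^sup>2 + a * u + 1 = 0 \<longleftrightarrow> u = a * v \<or> u = a * v + a" for u
  proof -
    have "(u + a * v) * (u + (a * v + a)) = u\<^sup>2 + a * u + a * v * (a * v + a) + 2 * (a * v * u)"
      by (simp add: algebra_simps power2_eq_square)
    then have "(u + a * v) * (u + (a * v + a)) = u\<^sup>2 + a * u + 1"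
      by (simp add: prod two_eq_zero)
    then show ?thesis
      by (metis add_eq_0_iff_eq mult_eq_0_iff)
  qed
  have "v ^ q + v = abs_trace k (1 / a\<^sup>2)"
    using abs_trace_artin_schreier[of k v] by (simp add: v q_def e_def)
  then show thesis
    using that[of v] roots prod by blast
qed

lemma norm_one_quadratic_roots_trace_0:
  fixes a :: 'a
  assumes a: "a ^ q = a" "a \<noteq> 0" and tr: "abs_trace k (1 / a\<^sup>2) = 0"
  shows "{u. u ^ (q + 1) = 1 \<and> u\<^sup>2 + a * u + 1 = 0} = {}"
proof -
  obtain v where v: "\<forall>u. u\<^sup>2 + a * u + 1 = 0 \<longleftrightarrow> u = a * v \<or> u = a * v + a"
    and fix_v: "v ^ q + v = abs_trace k (1 / a\<^sup>2)" and "a * v * (a * v + a) = 1"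
    by (rule quadratic_roots[OF a])
  have "v ^ q = v"
    using fix_v tr by (simp add: add_eq_0_iff_eq)
  then have fixed: "u ^ q = u" if "u\<^sup>2 + a * u + 1 = 0" for u
    using that a by (auto simp: v power_q_add power_mult_distrib)
  have "False" if "u ^ (q + 1) = 1" "u\<^sup>2 + a * u + 1 = 0" for u
  proof -
    have "u = 1"
      using that fixed norm_one_fixed by blast
    then have "1 + a + 1 = 0"
      using that by simp
    then show False
      using a by (simp add: add_eq_0_iff_eq two_eq_zero)
  qed
  then show ?thesis by blast
qed

lemma norm_one_quadratic_roots_trace_1:
  fixes a :: 'a
  assumes a: "a ^ q = a" "a \<noteq> 0" and tr: "abs_trace k (1 / a\<^sup>2) = 1"
  obtains u1 u2 where "u1 \<noteq> u2"
    and "{u. u ^ (q + 1) = 1 \<and> u\<^sup>2 + a * u + 1 = 0} = {u1, u2}"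
proof -
  obtain v where v: "\<forall>u. u\<^sup>2 + a * u + 1 = 0 \<longleftrightarrow> u = a * v \<or> u = a * v + a"
    and conj_v: "v ^ q + v = abs_trace k (1 / a\<^sup>2)" and prod: "a * v * (a * v + a) = 1"
    by (rule quadratic_roots[OF a])
  have "v ^ q = v + 1"
    using conj_v tr by (metis add.assoc add.commute add.right_neutral add_self)
  \<comment> \<open>The two roots are conjugate, so the norm of either is their product.\<close>
  then have "(a * v) ^ q = a * v + a"
    using a by (simp add: power_mult_distrib distrib_left)
  moreover from this have "(a * v + a) ^ q = a * v"
    using a by (simp add: power_q_add add.assoc add_self)
  ultimately have "(a * v) ^ (q + 1) = 1" "(a * v + a) ^ (q + 1) = 1"
    using prod by (simp_all add: mult.commute)
  then have "{u. u ^ (q + 1) = 1 \<and> u\<^sup>2 + a * u + 1 = 0} = {a * v, a * v + a}"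
    by (auto simp: v)
  then show thesis
    using that[of "a * v" "a * v + a"] a by simp
qed

end

section \<open>The number of zeros\<close>

theorem lemma3p3:
  fixes k q M :: nat
    and Fq :: "'a::{field,finite} set"
    and b c d :: 'a
    and f :: "'a poly"
    and \<chi> :: "'a \<Rightarrow> complex"
  assumes k: "k \<ge> 1" and q: "q = 2 ^ k"
    and card_UNIV: "card (UNIV :: 'a set) = q ^ 2"
    and Fq: "is_subfield Fq" "card Fq = q"
    and bc: "b \<in> Fq" "c \<in> Fq" "b \<noteq> 0"
    and chi: "\<chi> = can_char_ext k"
    and f: "f = monom 1 q + monom b 2 + monom c 1 + monom d 0"
    and M: "M = card {x. poly f x = 0}"
  shows
    "(c = 0 \<and> even k \<longrightarrow>
        (\<exists>x1. {x. x ^ (2 * q - 1) = b} = {x1} \<and>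
           of_nat M = 1 + \<chi> (d * x1))) \<and>
     (c = 0 \<and> odd k \<longrightarrow>
        (\<exists>x1 x2 x3. distinct [x1, x2, x3] \<and>
           {x. x ^ (2 * q - 1) = b} = {x1, x2, x3} \<and>
           of_nat M = 1 + \<chi> (d * x1) + \<chi> (d * x2) + \<chi> (d * x3))) \<and>
     (c = 1 \<longrightarrow> M = 1) \<and>
     (c \<notin> {0, 1} \<and> abs_trace k (1 / (c + 1) ^ 4) = 0 \<longrightarrow>
        of_nat M = 1 + \<chi> (d * b / (c + 1) ^ 2)) \<and>
     (c \<notin> {0, 1} \<and> abs_trace k (1 / (c + 1) ^ 4) = 1 \<longrightarrow>
        (\<exists>x1 x2. x1 \<noteq> x2 \<and>
           {x \<in> mu (q + 1) - {1}. x ^ 2 + (c + 1) ^ 2 * x + 1 = 0} = {x1, x2} \<and>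
           of_nat M = 1 + \<chi> (d * b / (x1 + c) ^ 2) + \<chi> (d * b / (x2 + c) ^ 2)
                        + \<chi> (d * b / (c + 1) ^ 2)))"
proof -
  interpret binary_quadratic_extension k q "TYPE('a)"
    by unfold_locales (use k q card_UNIV in simp_all)
  have b: "b ^ q = b" and c: "c ^ q = c"
    using subfield_power_card[OF Fq(1)] bc Fq(2) by auto
  have zeros: "{x. poly f x = 0} = {x. x ^ q + b * x\<^sup>2 + c * x + d = 0}"
    by (simp add: f poly_monom)
  have M_sum: "of_nat M = (\<Sum>w\<in>{w. w ^ (2 * q) + c\<^sup>2 * w\<^sup>2 + b * w = 0}. \<chi> (d * w))"
    unfolding M zeros chi by (rule card_zeros_eq_sum_adjoint)
  have chi_0: "\<chi> 0 = 1"
    by (simp add: chi can_char_ext_eq can_char_0)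

  have case1: "\<exists>x1. {x. x ^ (2 * q - 1) = b} = {x1} \<and> of_nat M = 1 + \<chi> (d * x1)"
    if "c = 0" "even k"
  proof -
    have roots: "{x. x ^ (2 * q - 1) = b} = {b}"
      using roots_eq_image_roots_of_unity[OF b bc(3)] roots_of_unity_even[OF that(2)] by simp
    have "of_nat M = (\<Sum>w\<in>{0, b}. \<chi> (d * w))"
      unfolding M_sum \<open>c = 0\<close> adjoint_zeros_c_0 roots ..
    then show ?thesis
      using roots bc(3) by (auto simp: chi_0)
  qed

  have case2: "\<exists>x1 x2 x3. distinct [x1, x2, x3] \<and> {x. x ^ (2 * q - 1) = b} = {x1, x2, x3} \<and>
      of_nat M = 1 + \<chi> (d * x1) + \<chi> (d * x2) + \<chi> (d * x3)"
    if "c = 0" "odd k"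
  proof -
    obtain v :: 'a where v: "{u. u ^ (2 * q - 1) = 1} = {1, v, v + 1}" "distinct [1, v, v + 1]"
      by (rule roots_of_unity_odd[OF \<open>odd k\<close>])
    define x2 x3 where "x2 = b * v" and "x3 = b * (v + 1)"
    have roots: "{x. x ^ (2 * q - 1) = b} = {b, x2, x3}"
      using roots_eq_image_roots_of_unity[OF b bc(3)] v(1) by (simp add: x2_def x3_def)
    have "v \<noteq> 0" "v + 1 \<noteq> 0"
      using v(2) by (auto simp: add_eq_0_iff_eq)
    then have nz: "x2 \<noteq> 0" "x3 \<noteq> 0"
      using bc(3) by (simp_all add: x2_def x3_def)
    have dist: "distinct [b, x2, x3]"
      using v(2) bc(3) unfolding x2_def x3_def by auto
    have "of_nat M = (\<Sum>w\<in>{0, b, x2, x3}. \<chi> (d * w))"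
      unfolding M_sum \<open>c = 0\<close> adjoint_zeros_c_0 roots ..
    then have "of_nat M = 1 + \<chi> (d * b) + \<chi> (d * x2) + \<chi> (d * x3)"
      using dist nz bc(3) by (auto simp: chi_0)
    then show ?thesis
      using roots dist by blast
  qed

  have case3: "M = 1" if "c = 1"
  proof -
    have "of_nat M = (1::complex)"
      unfolding M_sum \<open>c = 1\<close> adjoint_zeros_c_1[OF b bc(3)] by (simp add: chi_0)
    then show ?thesis by simp
  qed

  define R where "R = {u. u ^ (q + 1) = 1 \<and> (u = 1 \<or> u\<^sup>2 + (c + 1)\<^sup>2 * u + 1 = 0)}"
  have M_R: "of_nat M = 1 + (\<Sum>u\<in>R. \<chi> (d * b / (u + c)\<^sup>2))" if "c \<noteq> 1"
  proof -
    note z = adjoint_zeros_generic[OF b bc(3) c that, folded R_def]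
    have "of_nat M = \<chi> (d * 0) + (\<Sum>w\<in>(\<lambda>u. b / (u + c)\<^sup>2) ` R. \<chi> (d * w))"
      unfolding M_sum z(1) using z(3) by (intro sum.insert) auto
    also have "\<dots> = 1 + (\<Sum>u\<in>R. \<chi> (d * b / (u + c)\<^sup>2))"
      using z(2) by (simp add: sum.reindex chi_0)
    finally show ?thesis .
  qed
  define N where "N = {u. u ^ (q + 1) = 1 \<and> u\<^sup>2 + (c + 1)\<^sup>2 * u + 1 = 0}"
  have R_N: "R = insert 1 N"
    by (auto simp: R_def N_def)
  have a: "((c + 1)\<^sup>2) ^ q = (c + 1)\<^sup>2"
    by (simp add: c power_q_add mult.commute flip: power_mult)
       (simp add: c power_q_add power_mult mult.commute)
  have a_nz: "(c + 1)\<^sup>2 \<noteq> 0" if "c \<noteq> 1"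
    using that by (simp add: add_eq_0_iff_eq)
  have a_sq: "((c + 1)\<^sup>2)\<^sup>2 = (c + 1) ^ 4"
    by (simp flip: power_mult)
  have one_notin: "1 \<notin> N" if "c \<noteq> 1"
    using a_nz[OF that] by (simp add: N_def add_eq_0_iff_eq two_eq_zero)

  have case4: "of_nat M = 1 + \<chi> (d * b / (c + 1)\<^sup>2)"
    if "c \<noteq> 1" "abs_trace k (1 / (c + 1) ^ 4) = 0"
  proof -
    have tr: "abs_trace k (1 / ((c + 1)\<^sup>2)\<^sup>2) = 0"
      unfolding a_sq by (rule that(2))
    have "N = {}"
      unfolding N_def by (rule norm_one_quadratic_roots_trace_0[OF a a_nz[OF that(1)] tr])
    then show ?thesis
      using M_R[OF that(1)] by (simp add: R_N add.commute[of 1 c])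
  qed

  have case5: "\<exists>x1 x2. x1 \<noteq> x2 \<and>
      {x \<in> mu (q + 1) - {1}. x\<^sup>2 + (c + 1)\<^sup>2 * x + 1 = 0} = {x1, x2} \<and>
      of_nat M = 1 + \<chi> (d * b / (x1 + c)\<^sup>2) + \<chi> (d * b / (x2 + c)\<^sup>2) + \<chi> (d * b / (c + 1)\<^sup>2)"
    if "c \<noteq> 1" "abs_trace k (1 / (c + 1) ^ 4) = 1"
  proof -
    have tr: "abs_trace k (1 / ((c + 1)\<^sup>2)\<^sup>2) = 1"
      unfolding a_sq by (rule that(2))
    obtain u1 u2 where u: "u1 \<noteq> u2" "N = {u1, u2}"
      unfolding N_def by (rule norm_one_quadratic_roots_trace_1[OF a a_nz[OF \<open>c \<noteq> 1\<close>] tr])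
    have "{x \<in> mu (q + 1) - {1}. x\<^sup>2 + (c + 1)\<^sup>2 * x + 1 = 0} = N"
      using one_notin[OF that(1)] by (auto simp: N_def mu_def)
    moreover have "of_nat M = 1 + \<chi> (d * b / (u1 + c)\<^sup>2) + \<chi> (d * b / (u2 + c)\<^sup>2)
        + \<chi> (d * b / (c + 1)\<^sup>2)"
      using M_R[OF that(1)] u one_notin[OF that(1)]
      by (auto simp: R_N add.commute[of 1 c])
    ultimately show ?thesis
      using u by blast
  qed
  show ?thesis
    using case1 case2 case3 case4 case5 by auto
qed

end
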